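(* Let $\mathcal N$ be either of the algebras $\langle\mathbb N;+\rangle$ and $\langle\mathbb N;+,\times\rangle$. A function $f\colon\mathbb N\to\mathbb N$ is $\mathcal N$-stable preorder preserving if and only if it is monotone non decreasing (for the usual order of $\mathbb N$) and $\mathcal N$-congruence preserving.
   Context: $\mathbb N$ contains $0$. A preorder is a reflexive transitive relation. A binary relation $\rho$ on $\mathbb N$ is $\mathcal N$-stable if, for each operation $\ast$ of $\mathcal N$, $x\rho y$ and $x'\rho y'$ imply $(x\ast x')\,\rho\,(y\ast y')$. An $\mathcal N$-congruence is an $\mathcal N$-stable equivalence relation. $f$ is $\mathcal N$-stable preorder preserving (resp. $\mathcal N$-congruence preserving) if for every $\mathcal N$-stable preorder (resp. $\mathcal N$-congruence) $\rho$ on $\mathbb N$, $x\rho y$ implies $f(x)\rho f(y)$. *)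

theory Defs
  imports Main
begin

text \<open>An algebra whose operations are all binary is given by its carrier type \<open>'a\<close> and the set of
  its operations.\<close>

type_synonym 'a algebra = "('a \<Rightarrow> 'a \<Rightarrow> 'a) set"

definition stable :: "'a algebra \<Rightarrow> 'a rel \<Rightarrow> bool" where
  "stable N \<rho> \<longleftrightarrow>
     (\<forall>op \<in> N. \<forall>x y x' y'. (x, y) \<in> \<rho> \<longrightarrow> (x', y') \<in> \<rho> \<longrightarrow> (op x x', op y y') \<in> \<rho>)"

definition stable_preorder :: "'a algebra \<Rightarrow> 'a rel \<Rightarrow> bool" where
  "stable_preorder N \<rho> \<longleftrightarrow> preorder_on UNIV \<rho> \<and> stable N \<rho>"

definition congruence :: "'a algebra \<Rightarrow> 'a rel \<Rightarrow> bool" where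
  "congruence N \<rho> \<longleftrightarrow> equiv UNIV \<rho> \<and> stable N \<rho>"

definition preserves :: "('a \<Rightarrow> 'a) \<Rightarrow> 'a rel \<Rightarrow> bool" where
  "preserves f \<rho> \<longleftrightarrow> (\<forall>x y. (x, y) \<in> \<rho> \<longrightarrow> (f x, f y) \<in> \<rho>)"

definition stable_preorder_preserving :: "'a algebra \<Rightarrow> ('a \<Rightarrow> 'a) \<Rightarrow> bool" where
  "stable_preorder_preserving N f \<longleftrightarrow> (\<forall>\<rho>. stable_preorder N \<rho> \<longrightarrow> preserves f \<rho>)"

definition congruence_preserving :: "'a algebra \<Rightarrow> ('a \<Rightarrow> 'a) \<Rightarrow> bool" where
  "congruence_preserving N f \<longleftrightarrow> (\<forall>\<rho>. congruence N \<rho> \<longrightarrow> preserves f \<rho>)"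

definition nat_add :: "nat algebra" where
  "nat_add = {(+)}"

definition nat_add_mult :: "nat algebra" where
  "nat_add_mult = {(+), (*)}"

end

theory Submission
  imports Defs
begin

text \<open>The usual order is a stable preorder and every congruence is one, so a function preserving
  all stable preorders is monotone and congruence preserving.

  For the converse, testing \<open>f\<close> on the principal congruence that identifies \<open>a\<close> and \<open>a + d\<close>
  shows that either \<open>f a = f (a + d)\<close>, or \<open>a \<le> f a\<close> and \<open>d\<close> divides \<open>f (a + d) - f a\<close>
  (lemma \<open>congruence_preserving_values\<close>). Monotonicity makes this difference a natural multiple
  \<open>m * d\<close>, so that \<open>f (a + d)\<close> is reached from \<open>f a\<close> by \<open>m\<close> upward steps of length \<open>d\<close>, all
  starting at or above \<open>a\<close>. If a stable preorder relates \<open>a\<close> to \<open>a + d\<close>, it relates the ends of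
  each such step by translation, and hence \<open>f a\<close> to \<open>f (a + d)\<close> by transitivity; if it relates
  \<open>a + d\<close> to \<open>a\<close>, the same walk is taken downwards (lemma \<open>add_stable_preorder_steps\<close>).
  Multiplication changes nothing, because, being iterated addition, it respects every
  preorder that addition respects (lemma \<open>add_stable_preorder_imp_mult_stable\<close>).\<close>

lemma preorder_rules:
  assumes "preorder_on UNIV \<rho>"
  shows preorder_refl: "(x, x) \<in> \<rho>"
    and preorder_trans: "(x, y) \<in> \<rho> \<Longrightarrow> (y, z) \<in> \<rho> \<Longrightarrow> (x, z) \<in> \<rho>"
  using assms unfolding preorder_on_def refl_on_def by (blast dest: transD)+

lemma stable_addD:
  assumes "stable nat_add \<rho>" "(x, y) \<in> \<rho>" "(x', y') \<in> \<rho>"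
  shows "(x + x', y + y') \<in> \<rho>"
  using assms by (auto simp: stable_def nat_add_def)

text \<open>A product with a fixed factor \<open>c\<close> is a \<open>c\<close>-fold sum, reflexivity covering \<open>c = 0\<close>; a product
  in which both factors vary is handled by changing one factor at a time.\<close>

lemma add_stable_preorder_imp_mult_stable:
  assumes "stable_preorder nat_add \<rho>"
  shows "stable nat_add_mult \<rho>"
proof -
  from assms have pre: "preorder_on UNIV \<rho>" and st: "stable nat_add \<rho>"
    by (auto simp: stable_preorder_def)
  have scale: "(c * x, c * y) \<in> \<rho>" if "(x, y) \<in> \<rho>" for c x y
    by (induction c) (auto intro: preorder_refl[OF pre] stable_addD[OF st that])
  have "(x * x', y * y') \<in> \<rho>" if "(x, y) \<in> \<rho>" "(x', y') \<in> \<rho>" for x x' y y'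
  proof (rule preorder_trans[OF pre])
    show "(x * x', x * y') \<in> \<rho>"
      using scale[OF that(2)] .
    show "(x * y', y * y') \<in> \<rho>"
      using scale[OF that(1), of y'] by (simp add: mult.commute)
  qed
  with st show ?thesis
    by (auto simp: stable_def nat_add_def nat_add_mult_def)
qed

text \<open>The congruence generated by the pair \<open>(a, a + d)\<close>.\<close>

definition principal_congruence :: "nat \<Rightarrow> nat \<Rightarrow> nat rel" where
  "principal_congruence a d = {(x, y). x = y \<or> a \<le> x \<and> a \<le> y \<and> x mod d = y mod d}"

lemma congruence_principal_congruence:
  assumes "N = nat_add \<or> N = nat_add_mult"
  shows "congruence N (principal_congruence a d)"
proof -
  let ?\<rho> = "principal_congruence a d"
  have eq: "equiv UNIV ?\<rho>"
    by (rule equivI)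
      (auto simp: refl_on_def principal_congruence_def intro!: symI transI)
  then have pre: "preorder_on UNIV ?\<rho>"
    by (auto simp: equiv_def preorder_on_def)
  have "stable nat_add ?\<rho>"
    by (auto simp: stable_def nat_add_def principal_congruence_def intro: mod_add_cong)
  moreover from this pre have "stable nat_add_mult ?\<rho>"
    by (simp add: add_stable_preorder_imp_mult_stable stable_preorder_def)
  ultimately show ?thesis
    using assms eq by (auto simp: congruence_def)
qed

text \<open>Outside the diagonal, a principal congruence relates only numbers above its threshold \<open>a\<close>
  that agree modulo its period \<open>d\<close>; monotonicity turns the divisibility into a natural number
  of steps upwards.\<close>

lemma congruence_preserving_values:
  assumes N: "N = nat_add \<or> N = nat_add_mult"
    and "mono f" "congruence_preserving N f"
  shows "f a = f (a + d) \<or> a \<le> f a \<and> (\<exists>m. f (a + d) = f a + m * d)"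
proof -
  have "(a, a + d) \<in> principal_congruence a d"
    by (simp add: principal_congruence_def)
  then have "(f a, f (a + d)) \<in> principal_congruence a d"
    using assms(3) congruence_principal_congruence[OF N]
    unfolding congruence_preserving_def preserves_def by blast
  then consider "f a = f (a + d)" | "a \<le> f a" "f (a + d) mod d = f a mod d"
    by (auto simp: principal_congruence_def)
  then show ?thesis
  proof cases
    case 2
    have le: "f a \<le> f (a + d)"
      using \<open>mono f\<close> by (simp add: monoD)
    with 2 have "d dvd f (a + d) - f a"
      by (simp add: mod_eq_dvd_iff_nat)
    then obtain m where "f (a + d) - f a = m * d"
      by (metis dvdE mult.commute)
    with le have "f (a + d) = f a + m * d"
      by simp
    with 2 show ?thesis by blast
  qed simp
qed

lemma add_stable_preorder_steps:
  assumes "stable_preorder nat_add \<rho>" "a \<le> z"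
  shows "(a, a + d) \<in> \<rho> \<Longrightarrow> (z, z + m * d) \<in> \<rho>"
    and "(a + d, a) \<in> \<rho> \<Longrightarrow> (z + m * d, z) \<in> \<rho>"
proof -
  from assms have pre: "preorder_on UNIV \<rho>" and st: "stable nat_add \<rho>"
    by (auto simp: stable_preorder_def)
  \<comment> \<open>Translation by \<open>w - a\<close>, which exists exactly for \<open>w\<close> at or above \<open>a\<close>.\<close>
  have up: "(w, w + d) \<in> \<rho>" if "(a, a + d) \<in> \<rho>" "a \<le> w" for w
    using stable_addD[OF st that(1) preorder_refl[OF pre, of "w - a"]] that(2)
    by (simp add: algebra_simps)
  have down: "(w + d, w) \<in> \<rho>" if "(a + d, a) \<in> \<rho>" "a \<le> w" for w
    using stable_addD[OF st that(1) preorder_refl[OF pre, of "w - a"]] that(2)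
    by (simp add: algebra_simps)
  show "(z, z + m * d) \<in> \<rho>" if rel: "(a, a + d) \<in> \<rho>"
  proof (induction m)
    case (Suc m)
    have "(z + m * d, z + m * d + d) \<in> \<rho>"
      using up[OF rel] \<open>a \<le> z\<close> by simp
    from preorder_trans[OF pre Suc this] show ?case
      by (simp add: algebra_simps)
  qed (simp add: preorder_refl[OF pre])
  show "(z + m * d, z) \<in> \<rho>" if rel: "(a + d, a) \<in> \<rho>"
  proof (induction m)
    case (Suc m)
    have "(z + m * d + d, z + m * d) \<in> \<rho>"
      using down[OF rel] \<open>a \<le> z\<close> by simp
    from preorder_trans[OF pre this Suc] show ?case
      by (simp add: algebra_simps)
  qed (simp add: preorder_refl[OF pre])
qed

lemma stable_preorder_le:
  assumes "N = nat_add \<or> N = nat_add_mult"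
  shows "stable_preorder N {(x, y). x \<le> y}"
  using assms
  by (auto simp: stable_preorder_def preorder_on_def refl_on_def stable_def nat_add_def
      nat_add_mult_def add_mono mult_le_mono intro!: transI)

theorem theorem4p13:
  fixes N :: "nat algebra" and f :: "nat \<Rightarrow> nat"
  assumes "N = nat_add \<or> N = nat_add_mult"
  shows "stable_preorder_preserving N f \<longleftrightarrow> mono f \<and> congruence_preserving N f"
proof
  assume pres: "stable_preorder_preserving N f"
  have "preserves f {(x, y). x \<le> y}"
    using pres stable_preorder_le[OF assms] by (simp add: stable_preorder_preserving_def)
  then have "mono f"
    by (auto simp: preserves_def intro: monoI)
  moreover have "stable_preorder N \<rho>" if "congruence N \<rho>" for \<rho>
    using that by (auto simp: congruence_def stable_preorder_def equiv_def preorder_on_def)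
  with pres have "congruence_preserving N f"
    by (simp add: stable_preorder_preserving_def congruence_preserving_def)
  ultimately show "mono f \<and> congruence_preserving N f" ..
next
  assume "mono f \<and> congruence_preserving N f"
  then have steps: "f a = f (a + d) \<or> a \<le> f a \<and> (\<exists>m. f (a + d) = f a + m * d)" for a d
    using congruence_preserving_values[OF assms] by blast
  show "stable_preorder_preserving N f"
    unfolding stable_preorder_preserving_def preserves_def
  proof (intro allI impI)
    fix \<rho> x y
    assume "stable_preorder N \<rho>" and xy: "(x, y) \<in> \<rho>"
    with assms have sp: "stable_preorder nat_add \<rho>"
      by (auto simp: stable_preorder_def stable_def nat_add_def nat_add_mult_def)
    then have refl: "(z, z) \<in> \<rho>" for z
      by (auto simp: stable_preorder_def intro: preorder_refl)
    show "(f x, f y) \<in> \<rho>"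
    proof (cases "x \<le> y")
      case True
      then obtain d where y: "y = x + d"
        using le_Suc_ex by blast
      show ?thesis
        using steps[of x d] xy refl add_stable_preorder_steps(1)[OF sp] unfolding y by metis
    next
      case False
      then obtain d where x: "x = y + d"
        using le_Suc_ex nat_le_linear by blast
      show ?thesis
        using steps[of y d] xy refl add_stable_preorder_steps(2)[OF sp] unfolding x by metis
    qed
  qed
qed

end
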